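(* Suppose $\mathrm{MA}_{\aleph_1}(K)$ holds. Then for every partition $p:[\omega_1]^2\to\omega$ which witnesses $\mathrm{U}(\omega_1,\omega_1,\omega,\omega)$ and every coloring $c:[\omega_1]^2\to\omega$, there is a decomposition into pairwise disjoint sets $\omega_1=\biguplus_{i<\omega}X_i$ such that for all $i,j<\omega$ the set $\{c(\alpha,\beta)\mid(\alpha,\beta)\in[X_i]^2\ \&\ p(\alpha,\beta)=j\}$ is finite.
   Context: $[A]^2$ denotes pairs $(\alpha,\beta)$ from $A$ with $\alpha<\beta$; for sets of ordinals $a<b$ means every element of $a$ is below every element of $b$, and for a family $\mathcal B$, $[\mathcal B]^2=\{(a,b)\in\mathcal B^2\mid a<b\}$. $p:[\omega_1]^2\to\omega$ witnesses $\mathrm{U}(\omega_1,\omega_1,\omega,\omega)$ iff for every $\sigma<\omega$, every uncountable family $\mathcal A$ of pairwise disjoint subsets of $\omega_1$ each of size $\sigma$, and every $\delta<\omega$, there is an uncountable $\mathcal B\subseteq\mathcal A$ with $\min(p[a\times b])>\delta$ for all $(a,b)\in[\mathcal B]^2$. $\mathrm{MA}_{\aleph_1}(K)$: for every poset with Property K (every uncountable set of conditions contains an uncountable set of pairwise compatible conditions) and every $\aleph_1$ many dense subsets, there is a filter meeting all of them. *)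

theory Defs
  imports "HOL-Library.Countable_Set_Type" "HOL-Library.Disjoint_Sets"
begin

unbundle cardinal_syntax

section \<open>The ordinal \<open>\<omega>\<^sub>1\<close>\<close>

text \<open>
  \<open>\<omega>\<^sub>1\<close> is the successor cardinal of \<open>\<omega>\<close>, which the library provides as a well-order on sets of
  natural numbers. The lemmas \<open>uncountable_omega1\<close> and \<open>countable_below_omega1\<close> confirm that the
  resulting well-ordered type has order type \<open>\<omega>\<^sub>1\<close>.
\<close>

lemma Card_order_cardSuc_natLeq: "Card_order (cardSuc natLeq)"
  by (simp add: cardSuc_Card_order natLeq_Card_order)

lemma well_order_cardSuc_natLeq: "Well_order (cardSuc natLeq)"
  using Card_order_cardSuc_natLeq by (simp add: card_order_on_def)

typedef omega1 = "Field (cardSuc natLeq)"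
proof -
  have "infinite (Field (cardSuc natLeq))"
    using cardSuc_finite[OF natLeq_Card_order] Field_natLeq infinite_UNIV_nat by metis
  then show ?thesis
    using infinite_imp_nonempty by blast
qed

instantiation omega1 :: wellorder
begin

definition less_eq_omega1 :: "omega1 \<Rightarrow> omega1 \<Rightarrow> bool" where
  "x \<le> y \<longleftrightarrow> (Rep_omega1 x, Rep_omega1 y) \<in> cardSuc natLeq"

definition less_omega1 :: "omega1 \<Rightarrow> omega1 \<Rightarrow> bool" where
  "x < y \<longleftrightarrow> x \<le> y \<and> x \<noteq> (y :: omega1)"

instance
proof
  have wo: "refl_on (Field (cardSuc natLeq)) (cardSuc natLeq)" "trans (cardSuc natLeq)"
    "antisym (cardSuc natLeq)" "total_on (Field (cardSuc natLeq)) (cardSuc natLeq)"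
    "wf (cardSuc natLeq - Id)"
    using well_order_cardSuc_natLeq
    by (simp_all add: well_order_on_def linear_order_on_def partial_order_on_def preorder_on_def)
  fix x y z :: omega1
  show refl: "x \<le> x"
    using wo(1) Rep_omega1[of x] by (simp add: less_eq_omega1_def refl_on_def)
  show "x \<le> y \<Longrightarrow> y \<le> z \<Longrightarrow> x \<le> z"
    using wo(2) unfolding less_eq_omega1_def by (rule transD)
  show anti: "x \<le> y \<Longrightarrow> y \<le> x \<Longrightarrow> x = y"
    using wo(3) unfolding less_eq_omega1_def by (metis Rep_omega1_inject antisymD)
  show "x < y \<longleftrightarrow> x \<le> y \<and> \<not> y \<le> x"
    unfolding less_omega1_def using refl anti by blast
  show "x \<le> y \<or> y \<le> x"
    using wo(4) Rep_omega1[of x] Rep_omega1[of y] refl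
    unfolding less_eq_omega1_def total_on_def by (metis Rep_omega1_inject)
next
  fix P :: "omega1 \<Rightarrow> bool" and a :: omega1
  assume step: "\<And>x. (\<And>y. y < x \<Longrightarrow> P y) \<Longrightarrow> P x"
  have "wf (inv_image (cardSuc natLeq - Id) Rep_omega1)"
    using well_order_cardSuc_natLeq by (simp add: well_order_on_def)
  then show "P a"
  proof (induction a rule: wf_induct_rule)
    case (less x)
    show ?case
      by (rule step) (auto intro!: less simp: less_omega1_def less_eq_omega1_def Rep_omega1_inject)
  qed
qed

end

lemma card_of_omega1: "|UNIV :: omega1 set| =o cardSuc natLeq"
proof -
  have "bij_betw Rep_omega1 UNIV (Field (cardSuc natLeq))"
    using type_definition.Rep_range[OF type_definition_omega1]
    by (simp add: bij_betw_def inj_def Rep_omega1_inject)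
  then have "|UNIV :: omega1 set| =o |Field (cardSuc natLeq)|"
    using card_of_ordIso by blast
  then show ?thesis
    using card_of_Field_ordIso[OF Card_order_cardSuc_natLeq] ordIso_transitive by blast
qed

lemma uncountable_omega1: "uncountable (UNIV :: omega1 set)"
proof
  assume "countable (UNIV :: omega1 set)"
  then have "|UNIV :: omega1 set| \<le>o natLeq"
    by (simp add: countable_card_le_natLeq)
  then have "cardSuc natLeq \<le>o natLeq"
    by (rule ordIso_ordLeq_trans[OF ordIso_symmetric[OF card_of_omega1]])
  then show False
    using cardSuc_greater[OF natLeq_Card_order] not_ordLess_ordLeq by blast
qed

lemma countable_below_omega1: "countable {..< \<alpha> :: omega1}"
proof -
  have "|underS (cardSuc natLeq) (Rep_omega1 \<alpha>)| <o cardSuc natLeq"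
    using card_of_underS[OF Card_order_cardSuc_natLeq Rep_omega1] .
  then have "countable (underS (cardSuc natLeq) (Rep_omega1 \<alpha>))"
    using cardSuc_ordLeq_ordLess[OF natLeq_Card_order card_of_Card_order] countable_card_le_natLeq
    by blast
  moreover have "Rep_omega1 ` {..<\<alpha>} \<subseteq> underS (cardSuc natLeq) (Rep_omega1 \<alpha>)"
    by (auto simp: underS_def less_omega1_def less_eq_omega1_def Rep_omega1_inject)
  ultimately have "countable (Rep_omega1 ` {..<\<alpha>})"
    using countable_subset by blast
  then show ?thesis
    by (rule countable_image_inj_on) (simp add: inj_on_def Rep_omega1_inject)
qed


section \<open>Increasing pairs and the principle \<open>U(\<omega>\<^sub>1,\<omega>\<^sub>1,\<omega>,\<omega>)\<close>\<close>

definition pairs2 :: "'a::linorder set \<Rightarrow> ('a \<times> 'a) set" where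
  "pairs2 A = {(\<alpha>, \<beta>). \<alpha> \<in> A \<and> \<beta> \<in> A \<and> \<alpha> < \<beta>}"

definition set_below :: "'a::linorder set \<Rightarrow> 'a set \<Rightarrow> bool" where
  "set_below a b \<longleftrightarrow> (\<forall>\<alpha>\<in>a. \<forall>\<beta>\<in>b. \<alpha> < \<beta>)"

definition family_pairs2 :: "'a::linorder set set \<Rightarrow> ('a set \<times> 'a set) set" where
  "family_pairs2 B = {(a, b). a \<in> B \<and> b \<in> B \<and> set_below a b}"

text \<open>
  Functions on \<open>[\<omega>\<^sub>1]\<^sup>2\<close> are represented by total functions on pairs, of which only the values on
  increasing pairs are ever used. Since an uncountable pairwise disjoint family of sets of size
  \<open>\<sigma>\<close> exists only for \<open>\<sigma> > 0\<close>, the minimum below is always that of a finite nonempty set.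
\<close>

definition witnesses_U :: "(omega1 \<times> omega1 \<Rightarrow> nat) \<Rightarrow> bool" where
  "witnesses_U p \<longleftrightarrow>
    (\<forall>(\<sigma>::nat) (A::omega1 set set) (\<delta>::nat).
      uncountable A \<and> disjoint A \<and> (\<forall>a\<in>A. finite a \<and> card a = \<sigma>) \<longrightarrow>
      (\<exists>B\<subseteq>A. uncountable B \<and> (\<forall>(a, b)\<in>family_pairs2 B. \<delta> < Min (p ` (a \<times> b)))))"


section \<open>Martin's axiom for posets with Property K\<close>

text \<open>A poset is a carrier \<open>P\<close> with a relation \<open>le\<close>, where \<open>(x, y) \<in> le\<close> means that \<open>x\<close> extends \<open>y\<close>.\<close>

definition compatible_in :: "'p set \<Rightarrow> 'p rel \<Rightarrow> 'p \<Rightarrow> 'p \<Rightarrow> bool" where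
  "compatible_in P le x y \<longleftrightarrow> (\<exists>z\<in>P. (z, x) \<in> le \<and> (z, y) \<in> le)"

definition property_K :: "'p set \<Rightarrow> 'p rel \<Rightarrow> bool" where
  "property_K P le \<longleftrightarrow>
    (\<forall>A\<subseteq>P. uncountable A \<longrightarrow>
      (\<exists>B\<subseteq>A. uncountable B \<and> (\<forall>x\<in>B. \<forall>y\<in>B. compatible_in P le x y)))"

definition dense_in_poset :: "'p set \<Rightarrow> 'p rel \<Rightarrow> 'p set \<Rightarrow> bool" where
  "dense_in_poset P le D \<longleftrightarrow> D \<subseteq> P \<and> (\<forall>x\<in>P. \<exists>d\<in>D. (d, x) \<in> le)"

definition poset_filter :: "'p set \<Rightarrow> 'p rel \<Rightarrow> 'p set \<Rightarrow> bool" where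
  "poset_filter P le G \<longleftrightarrow>
    G \<subseteq> P \<and> G \<noteq> {} \<and>
    (\<forall>x\<in>G. \<forall>y\<in>P. (x, y) \<in> le \<longrightarrow> y \<in> G) \<and>
    (\<forall>x\<in>G. \<forall>y\<in>G. \<exists>z\<in>G. (z, x) \<in> le \<and> (z, y) \<in> le)"

text \<open>
  HOL cannot quantify over types inside a formula, so the axiom is parametrized by the type that
  the carriers are drawn from; it speaks about all posets of cardinality at most that of the type.
  It has its full strength over every type with at least \<open>\<aleph>\<^sub>1\<close> elements, because a poset with
  Property K and \<open>\<aleph>\<^sub>1\<close> dense sets can be replaced by a subposet of size at most \<open>\<aleph>\<^sub>1\<close> closed under
  witnesses for density and compatibility; over smaller types it is weaker.
\<close>

definition MA_aleph1_K :: "'p itself \<Rightarrow> bool" where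
  "MA_aleph1_K _ \<longleftrightarrow>
    (\<forall>(P::'p set) le. P \<noteq> {} \<and> partial_order_on P le \<and> property_K P le \<longrightarrow>
      (\<forall>\<D>. |\<D>| \<le>o cardSuc natLeq \<and> (\<forall>D\<in>\<D>. dense_in_poset P le D) \<longrightarrow>
        (\<exists>G. poset_filter P le G \<and> (\<forall>D\<in>\<D>. G \<inter> D \<noteq> {}))))"

end

theory Submission
  imports Defs
begin

text \<open>
  The decomposition is added by finite approximations: a condition puts finitely many ordinals into
  the pieces and fixes, for finitely many pairs \<open>(i, j)\<close>, an upper bound for the colours that may
  occur in \<open>X\<^sub>i\<close> on pairs with \<open>p\<close>-value \<open>j\<close>. Uncountably many conditions may be assumed to make the
  same promises, to form a \<open>\<Delta>\<close>-system, and to have new parts lying entirely above one another. The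
  promises mention only finitely many values \<open>j\<close>, all at most some \<open>\<delta>\<close>, and by
  \<open>U(\<omega>\<^sub>1,\<omega>\<^sub>1,\<omega>,\<omega>)\<close> one can thin out so that \<open>p > \<delta>\<close> between any two new parts. Then no promise
  concerns the new pairs, so unions are conditions and the poset has Property K.
\<close>

section \<open>Thinning out uncountable families, up to the \<Delta>-system lemma\<close>

lemma uncountable_fibre:
  assumes "uncountable A" "countable (f ` A)"
  obtains y where "uncountable {x \<in> A. f x = y}"
proof -
  have "A = (\<Union>y\<in>f ` A. {x \<in> A. f x = y})"
    by auto
  with assms show ?thesis
    using that countable_UN[OF assms(2), of "\<lambda>y. {x \<in> A. f x = y}"] by metis
qed

text \<open>Take a maximal pairwise related subset \<open>M\<close> by Zorn. If \<open>M\<close>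
  were countable, only countably many elements of \<open>A\<close> would lie in \<open>M\<close> or
  be unrelated to some member of \<open>M\<close>, so a further element could be added.\<close>

lemma uncountable_pairwise_subset:
  assumes unc: "uncountable A"
    and sym: "\<And>x y. x \<in> A \<Longrightarrow> y \<in> A \<Longrightarrow> R x y \<Longrightarrow> R y x"
    and few: "\<And>x. x \<in> A \<Longrightarrow> countable {y \<in> A. \<not> R x y}"
  obtains B where "B \<subseteq> A" "uncountable B" "pairwise R B"
proof -
  define \<F> where "\<F> = {B. B \<subseteq> A \<and> pairwise R B}"
  have "\<exists>M\<in>\<F>. \<forall>X\<in>\<F>. M \<subseteq> X \<longrightarrow> X = M"
  proof (rule subset_Zorn_nonempty)
    show "\<F> \<noteq> {}"
      by (auto simp: \<F>_def)
  next
    fix \<C> assume C: "\<C> \<noteq> {}" "subset.chain \<F> \<C>"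
    have "R x y" if xy: "x \<in> \<Union>\<C>" "y \<in> \<Union>\<C>" "x \<noteq> y" for x y
    proof -
      obtain X Y where "X \<in> \<C>" "Y \<in> \<C>" "x \<in> X" "y \<in> Y"
        using xy by auto
      then obtain Z where "Z \<in> \<C>" "x \<in> Z" "y \<in> Z"
        using C(2) unfolding subset_chain_def by (metis subsetD)
      then show ?thesis
        using C(2) \<open>x \<noteq> y\<close> unfolding subset_chain_def \<F>_def pairwise_def by blast
    qed
    then show "\<Union>\<C> \<in> \<F>"
      using C(2) unfolding subset_chain_def \<F>_def pairwise_def by blast
  qed
  then obtain M where M: "M \<subseteq> A" "pairwise R M"
    and max: "\<And>X. X \<subseteq> A \<Longrightarrow> pairwise R X \<Longrightarrow> M \<subseteq> X \<Longrightarrow> X = M"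
    by (auto simp: \<F>_def)
  have "uncountable M"
  proof
    assume cM: "countable M"
    have "countable (M \<union> (\<Union>x\<in>M. {y \<in> A. \<not> R x y}))"
      using cM few M(1) by (intro countable_Un countable_UN) auto
    then have "\<not> A \<subseteq> M \<union> (\<Union>x\<in>M. {y \<in> A. \<not> R x y})"
      using unc countable_subset by blast
    then obtain y where y: "y \<in> A" "y \<notin> M" "\<And>x. x \<in> M \<Longrightarrow> R x y"
      by auto
    have "pairwise R (insert y M)"
      using M y sym unfolding pairwise_insert by blast
    then have "insert y M = M"
      using max[of "insert y M"] M y by blast
    with y show False
      by auto
  qed
  with M that show ?thesis
    by blast
qed

text \<open>This supplies the hypothesis \<open>few\<close> of
  \<open>uncountable_pairwise_subset\<close> when failure of the relation forces \<open>f a\<close>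
  to meet a countable set.\<close>

lemma countable_family_meeting:
  assumes "countable C" "\<And>x. x \<in> C \<Longrightarrow> countable {a \<in> A. x \<in> f a}"
  shows "countable {a \<in> A. f a \<inter> C \<noteq> {}}"
proof -
  have "{a \<in> A. f a \<inter> C \<noteq> {}} = (\<Union>x\<in>C. {a \<in> A. x \<in> f a})"
    by auto
  then show ?thesis
    using assms by simp
qed

text \<open>If some point lies in uncountably many members, remove it, use the induction hypothesis
  and put it back into the root. Otherwise each member meets only countably many others, and an
  uncountable disjoint subfamily exists, with empty root.\<close>

lemma delta_system_card:
  assumes "uncountable A" "\<And>a. a \<in> A \<Longrightarrow> finite a \<and> card a = n"
  shows "\<exists>B\<subseteq>A. \<exists>r. uncountable B \<and> pairwise (\<lambda>a b. a \<inter> b = r) B"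
  using assms
proof (induction n arbitrary: A)
  case 0
  then have "A \<subseteq> {{}}"
    by (metis card_0_eq insertI1 subsetI)
  then have "countable A"
    by (rule countable_subset) simp
  with 0 show ?case
    by simp
next
  case (Suc n)
  show ?case
  proof (cases "\<exists>x. uncountable {a \<in> A. x \<in> a}")
    case True
    then obtain x where x: "uncountable {a \<in> A. x \<in> a}"
      by auto
    define A' where "A' = (\<lambda>a. a - {x}) ` {a \<in> A. x \<in> a}"
    have "inj_on (\<lambda>a. a - {x}) {a \<in> A. x \<in> a}"
      by (auto simp: inj_on_def)
    then have "uncountable A'"
      using x unfolding A'_def by (metis countable_image_inj_on)
    moreover have "finite a \<and> card a = n" if "a \<in> A'" for a
      using that Suc.prems(2) by (auto simp: A'_def)
    ultimately obtain B r where B: "B \<subseteq> A'" "uncountable B" "pairwise (\<lambda>a b. a \<inter> b = r) B"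
      using Suc.IH[of A'] by auto
    have xB: "x \<notin> b" if "b \<in> B" for b
      using that B(1) by (auto simp: A'_def)
    then have "inj_on (insert x) B"
      by (metis inj_onI insert_ident)
    then have "uncountable (insert x ` B)"
      using B(2) by (metis countable_image_inj_on)
    moreover have "insert x ` B \<subseteq> A"
      using B(1) by (auto simp: A'_def insert_absorb)
    moreover have "pairwise (\<lambda>a b. a \<inter> b = insert x r) (insert x ` B)"
      using B(3) unfolding pairwise_def by auto
    ultimately show ?thesis
      by blast
  next
    case False
    have "countable {b \<in> A. \<not> a \<inter> b = {}}" if "a \<in> A" for a
      using countable_family_meeting[of a A "\<lambda>b. b"] False that Suc.prems(2)
      by (simp add: Int_commute countable_finite)
    then obtain B where "B \<subseteq> A" "uncountable B" "pairwise (\<lambda>a b. a \<inter> b = {}) B"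
      by (rule uncountable_pairwise_subset[OF Suc.prems(1), of "\<lambda>a b. a \<inter> b = {}", rotated])
        (auto simp: Int_commute)
    then show ?thesis
      by blast
  qed
qed

lemma delta_system:
  assumes "uncountable A" "\<And>a. a \<in> A \<Longrightarrow> finite a"
  obtains B r where "B \<subseteq> A" "uncountable B" "pairwise (\<lambda>a b. a \<inter> b = r) B"
proof -
  obtain n where n: "uncountable {a \<in> A. card a = n}"
    using uncountable_fibre[OF assms(1), of card] by auto
  have "finite a \<and> card a = n" if "a \<in> {a \<in> A. card a = n}" for a
    using that assms(2) by simp
  from delta_system_card[OF n this] obtain B r where "B \<subseteq> {a \<in> A. card a = n}" "uncountable B"
    "pairwise (\<lambda>a b. a \<inter> b = r) B"
    by auto
  then show ?thesis
    using that[of B r] by auto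
qed

section \<open>Cardinal bounds and moving Martin's axiom between types\<close>

text \<open>Subsets of size \<open>Suc n\<close> arise by inserting a point into subsets of size
  \<open>n\<close>, so products of infinite cardinals bound each size, and there are countably many
  sizes.\<close>

lemma card_of_finite_subsets:
  assumes "infinite A"
  shows "|{s. s \<subseteq> A \<and> finite s}| \<le>o |A|"
proof -
  have n: "|{s. s \<subseteq> A \<and> finite s \<and> card s = n}| \<le>o |A|" for n
  proof (induction n)
    case 0
    have "{s. s \<subseteq> A \<and> finite s \<and> card s = 0} = {{}}"
      by auto
    then show ?case
      using assms by (simp add: card_of_singl_ordLeq infinite_imp_nonempty)
  next
    case (Suc n)
    let ?S = "\<lambda>n. {s. s \<subseteq> A \<and> finite s \<and> card s = n}"
    have "?S (Suc n) \<subseteq> (\<lambda>(x, s). insert x s) ` (A \<times> ?S n)"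
    proof
      fix s assume s: "s \<in> ?S (Suc n)"
      then obtain x where "x \<in> s"
        by fastforce
      with s have "s = insert x (s - {x})" "x \<in> A" "s - {x} \<in> ?S n"
        by auto
      then show "s \<in> (\<lambda>(x, s). insert x s) ` (A \<times> ?S n)"
        by blast
    qed
    then have "|?S (Suc n)| \<le>o |A \<times> ?S n|"
      by (rule ordLeq_transitive[OF card_of_mono1 card_of_image])
    also have "|A \<times> ?S n| \<le>o |A|"
      using Suc assms
      by (intro card_of_Times_ordLeq_infinite_Field) (auto simp: Field_card_of card_of_card_order_on intro: card_of_mono1)
    finally show ?case .
  qed
  have "{s. s \<subseteq> A \<and> finite s} = (\<Union>n\<in>UNIV. {s. s \<subseteq> A \<and> finite s \<and> card s = n})"
    by auto
  moreover have "|\<Union>n\<in>(UNIV::nat set). {s. s \<subseteq> A \<and> finite s \<and> card s = n}| \<le>o |A|"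
    using n assms infinite_iff_card_of_nat by (intro card_of_UNION_ordLeq_infinite) auto
  ultimately show ?thesis
    by simp
qed

text \<open>The axiom is available only for carriers in \<open>'p\<close>. A poset of another type
  is copied into \<open>'p\<close> along an injection \<open>e\<close>, and the filter is pulled
  back.\<close>

lemma MA_aleph1_K_transfer:
  fixes P :: "'q set"
  assumes MA: "MA_aleph1_K TYPE('p)" and card: "|P| \<le>o |UNIV :: 'p set|"
    and P: "P \<noteq> {}" "partial_order_on P le" "property_K P le"
    and D: "|\<D>| \<le>o cardSuc natLeq" "\<And>D. D \<in> \<D> \<Longrightarrow> dense_in_poset P le D"
  obtains G where "poset_filter P le G" "\<forall>D\<in>\<D>. G \<inter> D \<noteq> {}"
proof -
  obtain e :: "'q \<Rightarrow> 'p" where e: "inj_on e P"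
    using card by (metis card_of_ordLeq)
  define Q where "Q = e ` P"
  define leQ where "leQ = map_prod e e ` le"
  \<comment> \<open>This keeps all comparisons inside \<open>P\<close>, where \<open>e\<close> is
    injective.\<close>
  have leP: "le \<subseteq> P \<times> P"
    using P(2) by (auto simp: partial_order_on_def preorder_on_def)
  have leQ_iff: "(e x, e y) \<in> leQ \<longleftrightarrow> (x, y) \<in> le" if "x \<in> P" "y \<in> P" for x y
  proof
    assume "(e x, e y) \<in> leQ"
    then obtain u v where "(u, v) \<in> le" "e u = e x" "e v = e y"
      by (auto simp: leQ_def)
    then show "(x, y) \<in> le"
      using leP that inj_onD[OF e] by blast
  qed (force simp: leQ_def)
  have leQQ: "leQ \<subseteq> Q \<times> Q"
    using leP by (auto simp: leQ_def Q_def)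
  have po: "partial_order_on Q leQ"
  proof -
    have "refl_on Q leQ"
      using P(2) leQ_iff by (auto simp: partial_order_on_def preorder_on_def refl_on_def Q_def)
    moreover have "trans leQ"
    proof (rule transI)
      fix x y z assume h: "(x, y) \<in> leQ" "(y, z) \<in> leQ"
      then obtain u v w where "x = e u" "y = e v" "z = e w" "u \<in> P" "v \<in> P" "w \<in> P"
        using leQQ unfolding Q_def by blast
      then show "(x, z) \<in> leQ"
        using h leQ_iff P(2) unfolding partial_order_on_def preorder_on_def
        by (metis transD)
    qed
    moreover have "antisym leQ"
    proof (rule antisymI)
      fix x y assume h: "(x, y) \<in> leQ" "(y, x) \<in> leQ"
      then obtain u v where "x = e u" "y = e v" "u \<in> P" "v \<in> P"
        using leQQ unfolding Q_def by blast
      then show "x = y"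
        using h leQ_iff P(2) unfolding partial_order_on_def by (metis antisymD)
    qed
    ultimately show ?thesis
      using leQQ by (simp add: partial_order_on_def preorder_on_def)
  qed
  have K: "property_K Q leQ"
    unfolding property_K_def
  proof (intro allI impI)
    fix A assume A: "A \<subseteq> Q" "uncountable A"
    define A' where "A' = {x \<in> P. e x \<in> A}"
    have "e ` A' = A"
      using A(1) by (auto simp: A'_def Q_def)
    then have "uncountable A'"
      using A(2) by (metis countable_image)
    then obtain B where B: "B \<subseteq> A'" "uncountable B"
      "\<And>x y. x \<in> B \<Longrightarrow> y \<in> B \<Longrightarrow> compatible_in P le x y"
      using P(3) unfolding property_K_def A'_def by (metis (no_types, lifting) mem_Collect_eq subsetI)
    have BP: "B \<subseteq> P"
      using B(1) by (auto simp: A'_def)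
    then have "uncountable (e ` B)"
      using B(2) e by (metis countable_image_inj_on inj_on_subset)
    moreover have "e ` B \<subseteq> A"
      using B(1) by (auto simp: A'_def)
    moreover have "compatible_in Q leQ (e x) (e y)" if "x \<in> B" "y \<in> B" for x y
      using B(3)[OF that] that BP leQ_iff unfolding compatible_in_def Q_def by blast
    ultimately show "\<exists>B\<subseteq>A. uncountable B \<and> (\<forall>x\<in>B. \<forall>y\<in>B. compatible_in Q leQ x y)"
      by blast
  qed
  have dense: "dense_in_poset Q leQ D'" if D': "D' \<in> (`) e ` \<D>" for D'
  proof -
    obtain D where D': "D' = e ` D" "D \<subseteq> P" "\<And>x. x \<in> P \<Longrightarrow> \<exists>d\<in>D. (d, x) \<in> le"
      using D' D(2) by (auto simp: dense_in_poset_def)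
    then have "\<exists>d\<in>D'. (d, e x) \<in> leQ" if "x \<in> P" for x
      using that leQ_iff by (metis image_eqI subsetD)
    then show ?thesis
      using D'(1,2) by (auto simp: dense_in_poset_def Q_def)
  qed
  have "|(`) e ` \<D>| \<le>o cardSuc natLeq"
    by (rule ordLeq_transitive[OF card_of_image D(1)])
  moreover have "Q \<noteq> {}"
    using P(1) by (simp add: Q_def)
  ultimately obtain G where G: "poset_filter Q leQ G" "\<And>D'. D' \<in> (`) e ` \<D> \<Longrightarrow> G \<inter> D' \<noteq> {}"
    using MA po K dense unfolding MA_aleph1_K_def by meson
  define G' where "G' = {x \<in> P. e x \<in> G}"
  \<comment> \<open>Pulling back loses nothing, since a filter on \<open>Q\<close> is contained in
    the range of \<open>e\<close> on \<open>P\<close>.\<close>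
  have GQ: "G = e ` G'"
    using G(1) by (auto simp: poset_filter_def G'_def Q_def)
  have G'P: "G' \<subseteq> P"
    by (auto simp: G'_def)
  have "poset_filter P le G'"
    unfolding poset_filter_def
  proof (intro conjI ballI impI)
    show "G' \<subseteq> P" by fact
    show "G' \<noteq> {}"
      using G(1) GQ by (auto simp: poset_filter_def)
  next
    fix x y assume "x \<in> G'" "y \<in> P" "(x, y) \<in> le"
    then show "y \<in> G'"
      using G(1) leQ_iff unfolding poset_filter_def G'_def Q_def by blast
  next
    fix x y assume xy: "x \<in> G'" "y \<in> G'"
    then have "\<exists>z\<in>G. (z, e x) \<in> leQ \<and> (z, e y) \<in> leQ"
      using G(1) GQ unfolding poset_filter_def by blast
    then show "\<exists>z\<in>G'. (z, x) \<in> le \<and> (z, y) \<in> le"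
      using leQ_iff xy G'P unfolding GQ by blast
  qed
  moreover have "G' \<inter> D \<noteq> {}" if "D \<in> \<D>" for D
  proof -
    have "G \<inter> e ` D \<noteq> {}" "D \<subseteq> P"
      using that G(2) D(2) by (auto simp: dense_in_poset_def)
    then show ?thesis
      by (auto simp: G'_def)
  qed
  ultimately show ?thesis
    using that by blast
qed

section \<open>The forcing notion\<close>

text \<open>
  A condition is a pair of finite functions given by their graphs: \<open>(\<alpha>, i) \<in> F\<close> decides that
  \<open>\<alpha>\<close> goes into \<open>X\<^sub>i\<close>, and \<open>((i, j), k) \<in> H\<close> promises that \<open>c\<close> is bounded by \<open>k\<close> on the pairs
  from \<open>X\<^sub>i\<close> on which \<open>p\<close> has value \<open>j\<close>.
\<close>

type_synonym cond = "(omega1 \<times> nat) set \<times> ((nat \<times> nat) \<times> nat) set"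

definition keeps_promises ::
  "(omega1 \<times> omega1 \<Rightarrow> nat) \<Rightarrow> (omega1 \<times> omega1 \<Rightarrow> nat) \<Rightarrow> cond \<Rightarrow> bool" where
  "keeps_promises p c = (\<lambda>(F, H). \<forall>\<alpha> \<beta> i k. (\<alpha>, i) \<in> F \<longrightarrow> (\<beta>, i) \<in> F \<longrightarrow> \<alpha> < \<beta> \<longrightarrow>
     ((i, p (\<alpha>, \<beta>)), k) \<in> H \<longrightarrow> c (\<alpha>, \<beta>) \<le> k)"

text \<open>With graphs, extending a condition is inclusion in both components, so a common
  extension is sought as a union.\<close>

definition conds :: "(omega1 \<times> omega1 \<Rightarrow> nat) \<Rightarrow> (omega1 \<times> omega1 \<Rightarrow> nat) \<Rightarrow> cond set" where
  "conds p c = {(F, H). finite F \<and> finite H \<and> single_valued F \<and> single_valued H \<and> keeps_promises p c (F, H)}"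

definition cond_le :: "(omega1 \<times> omega1 \<Rightarrow> nat) \<Rightarrow> (omega1 \<times> omega1 \<Rightarrow> nat) \<Rightarrow> cond rel" where
  "cond_le p c = {(q, r). q \<in> conds p c \<and> r \<in> conds p c \<and> fst r \<subseteq> fst q \<and> snd r \<subseteq> snd q}"

lemma partial_order_on_cond_le: "partial_order_on (conds p c) (cond_le p c)"
  unfolding partial_order_on_def preorder_on_def refl_on_def trans_def antisym_def cond_le_def
  by (auto simp: prod_eq_iff)

text \<open>This lets the conditions be embedded into \<open>'p\<close>: they are pairs of finite
  subsets of sets of size at most \<aleph>\<open>\<^sub>1\<close>.\<close>

lemma card_of_conds: "|conds p c| \<le>o cardSuc natLeq"
proof -
  have inf: "infinite (UNIV :: omega1 set)"
    using uncountable_omega1 uncountable_infinite by blast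
  then have nat: "|UNIV :: nat set| \<le>o |UNIV :: omega1 set|"
    using infinite_iff_card_of_nat by blast
  have times: "|A \<times> B| \<le>o |UNIV :: omega1 set|"
    if "|A| \<le>o |UNIV :: omega1 set|" "|B| \<le>o |UNIV :: omega1 set|" for A :: "'x set" and B :: "'y set"
    using that inf by (intro card_of_Times_ordLeq_infinite_Field) (auto simp: Field_card_of card_of_card_order_on)
  have "|{F :: (omega1 \<times> nat) set. F \<subseteq> UNIV \<and> finite F}| \<le>o |UNIV :: (omega1 \<times> nat) set|"
    using inf by (intro card_of_finite_subsets) (simp add: finite_prod)
  also have "|UNIV :: (omega1 \<times> nat) set| \<le>o |UNIV :: omega1 set|"
    using times[OF card_of_mono1[OF subset_UNIV] nat, of UNIV] by simp
  finally have F: "|{F :: (omega1 \<times> nat) set. finite F}| \<le>o |UNIV :: omega1 set|"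
    by simp
  have "|{H :: ((nat \<times> nat) \<times> nat) set. finite H}| \<le>o natLeq"
    using countable_Collect_finite by (simp flip: countable_card_le_natLeq)
  then have H: "|{H :: ((nat \<times> nat) \<times> nat) set. finite H}| \<le>o |UNIV :: omega1 set|"
    by (rule ordLeq_transitive[OF ordLeq_ordIso_trans[OF _ ordIso_symmetric[OF card_of_nat]] nat])
  have "conds p c \<subseteq> {F. finite F} \<times> {H. finite H}"
    by (auto simp: conds_def)
  then have "|conds p c| \<le>o |UNIV :: omega1 set|"
    by (rule ordLeq_transitive[OF card_of_mono1 times[OF F H]])
  then show ?thesis
    by (rule ordLeq_ordIso_trans[OF _ card_of_omega1])
qed

section \<open>Property K of the forcing\<close>

lemma property_K_conds:
  assumes U: "witnesses_U p"
  shows "property_K (conds p c) (cond_le p c)"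
  unfolding property_K_def
proof (intro allI impI)
  fix A assume A: "A \<subseteq> conds p c" "uncountable A"
  \<comment> \<open>Promises are finite subsets of a countable set, so uncountably many conditions
    share one \<open>H\<close>.\<close>
  have "countable (snd ` A)"
    by (rule countable_subset[OF _ countable_Collect_finite]) (use A(1) in \<open>auto simp: conds_def\<close>)
  from uncountable_fibre[OF A(2) this] obtain H where H: "uncountable {q \<in> A. snd q = H}" .
  define \<F> where "\<F> = {F. (F, H) \<in> A}"
  have "{q \<in> A. snd q = H} = (\<lambda>F. (F, H)) ` \<F>"
    by (auto simp: \<F>_def)
  then have "uncountable \<F>"
    using H by (metis countable_image)
  have cond: "(F, H) \<in> conds p c" if "F \<in> \<F>" for F
    using that A(1) by (auto simp: \<F>_def)
  then have fin: "finite F" and sv: "single_valued F" and resp: "keeps_promises p c (F, H)"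
    and finH: "finite H" and svH: "single_valued H" if "F \<in> \<F>" for F
    using that by (auto simp: conds_def)
  obtain \<G> R where G: "\<G> \<subseteq> \<F>" "uncountable \<G>" "pairwise (\<lambda>a b. a \<inter> b = R) \<G>"
    by (rule delta_system[OF \<open>uncountable \<F>\<close> fin])
  \<comment> \<open>\<open>R\<close> is the intersection of \<open>F\<close> with any other
    member.\<close>
  have RG: "R \<subseteq> F" if "F \<in> \<G>" for F
  proof -
    have "uncountable (\<G> - {F})"
      using G(2) by simp
    then have "\<G> - {F} \<noteq> {}"
      by (metis countable_empty)
    then obtain F' where "F' \<in> \<G>" "F' \<noteq> F"
      by auto
    then show ?thesis
      using G(3) that unfolding pairwise_def by blast
  qed
  \<comment> \<open>The \<Delta>-system consists of graphs, but \<open>witnesses_U\<close> concerns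
    sets of ordinals. The graphs \<open>F - R\<close> are disjoint, yet their domains may still
    overlap, because one ordinal can be sent to different pieces.\<close>
  define d where "d F = Domain (F - R)" for F
  have fin_d: "finite (d F)" if "F \<in> \<F>" for F
    using fin[OF that] by (simp add: d_def finite_Domain)
  \<comment> \<open>Since every member contains \<open>R\<close>, dropping \<open>R\<close> itself
    makes all \<open>d F\<close> nonempty; injectivity of \<open>d\<close> will rest on
    this.\<close>
  define \<G>1 where "\<G>1 = \<G> - {R}"
  have G1: "\<G>1 \<subseteq> \<F>" "uncountable \<G>1"
    using G(1,2) uncountable_minus_countable[OF G(2), of "{R}"] by (auto simp: \<G>1_def)
  have d_ne: "d F \<noteq> {}" if "F \<in> \<G>1" for F
    using that RG by (auto simp: d_def \<G>1_def)
  \<comment> \<open>Outside the root, a pair \<open>(\<alpha>, i)\<close> lies in at most one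
    member, and there are only countably many \<open>i\<close>.\<close>
  have at_point: "countable {F \<in> \<G>1. \<alpha> \<in> d F}" for \<alpha>
  proof -
    have one: "countable {F \<in> \<G>1. (\<alpha>, i) \<in> F - R}" for i
    proof -
      have "F = F'" if "F \<in> \<G>1" "F' \<in> \<G>1" "(\<alpha>, i) \<in> F - R" "(\<alpha>, i) \<in> F' - R" for F F'
        using that G(3) unfolding \<G>1_def pairwise_def by blast
      then have "{F \<in> \<G>1. (\<alpha>, i) \<in> F - R} \<subseteq> {THE F. F \<in> \<G>1 \<and> (\<alpha>, i) \<in> F - R}"
        by (auto intro!: the_equality[symmetric])
      then show ?thesis
        by (rule countable_subset) simp
    qed
    have "{F \<in> \<G>1. \<alpha> \<in> d F} = (\<Union>i. {F \<in> \<G>1. (\<alpha>, i) \<in> F - R})"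
      by (auto simp: d_def)
    then show ?thesis
      using one by simp
  qed
  define S where "S F F' \<longleftrightarrow> set_below (d F) (d F') \<or> set_below (d F') (d F)" for F F'
  \<comment> \<open>If \<open>d F\<close> is not below \<open>d F'\<close>, then \<open>d F'\<close>
    has a point at or below some point of \<open>d F\<close>, hence meets a countable initial part
    of \<open>\<omega>\<^sub>1\<close>.\<close>
  have "countable {F' \<in> \<G>1. \<not> S F F'}" if "F \<in> \<G>1" for F
  proof -
    have "{..\<alpha>} = insert \<alpha> {..<\<alpha>}" for \<alpha> :: omega1
      by auto
    then have "countable (\<Union>\<alpha>\<in>d F. {..\<alpha>})"
      using fin_d that G1(1) countable_below_omega1
      by (auto intro!: countable_UN simp: countable_finite)
    from countable_family_meeting[OF this, of \<G>1 d] at_point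
    have "countable {F' \<in> \<G>1. d F' \<inter> (\<Union>\<alpha>\<in>d F. {..\<alpha>}) \<noteq> {}}"
      by blast
    then show ?thesis
      by (rule countable_subset[rotated]) (force simp: S_def set_below_def)
  qed
  then obtain \<G>2 where G2: "\<G>2 \<subseteq> \<G>1" "uncountable \<G>2" "pairwise S \<G>2"
    by (rule uncountable_pairwise_subset[OF G1(2), of S, rotated]) (auto simp: S_def)
  obtain \<sigma> where \<sigma>: "uncountable {F \<in> \<G>2. card (d F) = \<sigma>}"
    using uncountable_fibre[OF G2(2), of "\<lambda>F. card (d F)"] by auto
  define \<G>3 where "\<G>3 = {F \<in> \<G>2. card (d F) = \<sigma>}"
  have G3: "\<G>3 \<subseteq> \<G>1" "uncountable \<G>3" "pairwise S \<G>3"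
    using G2 \<sigma> by (auto simp: \<G>3_def pairwise_def)
  have disj: "d F \<inter> d F' = {}" if "F \<in> \<G>3" "F' \<in> \<G>3" "F \<noteq> F'" for F F'
    using G3(3) that unfolding pairwise_def S_def set_below_def by fastforce
  \<comment> \<open>Disjoint nonempty sets are distinct, so the family of all \<open>d F\<close> is
    still uncountable.\<close>
  then have inj: "inj_on d \<G>3"
    using d_ne G3(1) by (metis inf.idem inj_onI subsetD)
  \<comment> \<open>A bound for all values \<open>j\<close> that the common promise mentions. For
    empty \<open>H\<close> the value is unspecified, but it is compared only with a \<open>j\<close>
    occurring in \<open>H\<close>.\<close>
  define \<delta> where "\<delta> = Max ((\<lambda>((i, j), k). j) ` H)"
  have "uncountable (d ` \<G>3)"
    using inj G3(2) countable_image_inj_on by blast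
  moreover have "disjoint (d ` \<G>3)"
    using disj by (auto simp: disjoint_def)
  moreover have "\<forall>a\<in>d ` \<G>3. finite a \<and> card a = \<sigma>"
    using fin_d G3(1) G1(1) by (auto simp: \<G>3_def)
  ultimately obtain \<B> where B: "\<B> \<subseteq> d ` \<G>3" "uncountable \<B>"
    "\<forall>(a, b)\<in>family_pairs2 \<B>. \<delta> < Min (p ` (a \<times> b))"
    using U unfolding witnesses_U_def by meson
  define \<G>4 where "\<G>4 = {F \<in> \<G>3. d F \<in> \<B>}"
  have "\<B> = d ` \<G>4"
    using B(1) by (auto simp: \<G>4_def)
  then have G4: "uncountable \<G>4"
    using B(2) by (metis countable_image)
  \<comment> \<open>The new parts are comparable, and \<open>\<alpha> < \<beta>\<close> decides
    which is below; then the pair belongs to \<open>family_pairs2 \<B>\<close>.\<close>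
  have large: "\<delta> < p (\<alpha>, \<beta>)"
    if "F \<in> \<G>4" "F' \<in> \<G>4" "F \<noteq> F'" "\<alpha> \<in> d F" "\<beta> \<in> d F'" "\<alpha> < \<beta>" for F F' \<alpha> \<beta>
  proof -
    have "S F F'"
      using G3(3) that unfolding \<G>4_def pairwise_def by blast
    then have "set_below (d F) (d F')"
      using that(4-6) unfolding S_def set_below_def by (metis less_asym)
    then have "\<delta> < Min (p ` (d F \<times> d F'))"
      using B(3) that(1,2) unfolding family_pairs2_def \<G>4_def by blast
    moreover have "finite (d F)" "finite (d F')"
      using that(1,2) fin_d G3(1) G1(1) by (auto simp: \<G>4_def)
    then have "Min (p ` (d F \<times> d F')) \<le> p (\<alpha>, \<beta>)"
      using that by (intro Min_le) auto
    ultimately show ?thesis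
      by simp
  qed
  have G4F: "F \<in> \<F>" "R \<subseteq> F" if "F \<in> \<G>4" for F
    using that G3(1) G1(1) RG by (auto simp: \<G>4_def \<G>1_def)
  have compat: "compatible_in (conds p c) (cond_le p c) (F, H) (F', H)"
    if F: "F \<in> \<G>4" "F' \<in> \<G>4" "F \<noteq> F'" for F F'
  proof -
    have F\<F>: "F \<in> \<F>" "F' \<in> \<F>" "R \<subseteq> F" "R \<subseteq> F'"
      using F G4F by auto
    have dd: "d F \<inter> d F' = {}"
      using F disj by (auto simp: \<G>4_def)
    \<comment> \<open>If one of the two pairs is in the root, both graphs contain it and
      single-valuedness applies; otherwise \<open>\<alpha>\<close> would lie in both disjoint sets
      \<open>d F\<close> and \<open>d F'\<close>.\<close>
    have agree: "i = j" if "(\<alpha>, i) \<in> F" "(\<alpha>, j) \<in> F'" for \<alpha> i j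
    proof (cases "(\<alpha>, i) \<in> R \<or> (\<alpha>, j) \<in> R")
      case True
      then show ?thesis
        using that F\<F> sv[of F] sv[of F'] unfolding single_valued_def by blast
    next
      case False
      then show ?thesis
        using that dd by (auto simp: d_def)
    qed
    then have "single_valued (F \<union> F')"
      using sv[OF F\<F>(1)] sv[OF F\<F>(2)] unfolding single_valued_def by blast
    moreover have "keeps_promises p c (F \<union> F', H)"
      unfolding keeps_promises_def prod.case
    proof (intro allI impI)
      fix \<alpha> \<beta> i k
      assume h: "(\<alpha>, i) \<in> F \<union> F'" "(\<beta>, i) \<in> F \<union> F'" "\<alpha> < \<beta>" "((i, p (\<alpha>, \<beta>)), k) \<in> H"
      have "p (\<alpha>, \<beta>) \<in> (\<lambda>((i, j), k). j) ` H"
        using h(4) by force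
      then have small: "p (\<alpha>, \<beta>) \<le> \<delta>"
        using finH[OF F\<F>(1)] unfolding \<delta>_def by (intro Max_ge) auto
      \<comment> \<open>If the two points are not in one common graph, each belongs to exactly one
        graph, hence lies outside the root. Then \<open>large\<close> puts
        \<open>p (\<alpha>, \<beta>)\<close> above \<delta>, against \<open>small\<close>.\<close>
      have "(\<alpha>, i) \<in> F \<and> (\<beta>, i) \<in> F \<or> (\<alpha>, i) \<in> F' \<and> (\<beta>, i) \<in> F'"
      proof (rule ccontr)
        assume "\<not> ?thesis"
        then have "\<alpha> \<in> d F \<and> \<beta> \<in> d F' \<or> \<alpha> \<in> d F' \<and> \<beta> \<in> d F"
          using h(1,2) F\<F>(3,4) unfolding d_def by blast
        then show False
          using large[OF F] large[OF F(2,1)] F(3) h(3) small by fastforce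
      qed
      then show "c (\<alpha>, \<beta>) \<le> k"
        using resp[OF F\<F>(1)] resp[OF F\<F>(2)] h(3,4) unfolding keeps_promises_def by blast
    qed
    ultimately have "(F \<union> F', H) \<in> conds p c"
      using fin finH svH F\<F> by (simp add: conds_def)
    then show ?thesis
      unfolding compatible_in_def cond_le_def using cond F\<F> by force
  qed
  have compat': "compatible_in (conds p c) (cond_le p c) (F, H) (F', H)"
    if F: "F \<in> \<G>4" "F' \<in> \<G>4" for F F'
  proof (cases "F = F'")
    case True
    then show ?thesis
      unfolding compatible_in_def cond_le_def using cond[OF G4F(1)[OF F(1)]] by force
  qed (use F compat in blast)
  have "uncountable ((\<lambda>F. (F, H)) ` \<G>4)"
    using G4 countable_image_inj_on[of "\<lambda>F. (F, H)" \<G>4] by (auto simp: inj_on_def)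
  moreover have "(\<lambda>F. (F, H)) ` \<G>4 \<subseteq> A"
    using G4F(1) by (auto simp: \<F>_def)
  ultimately show "\<exists>B\<subseteq>A. uncountable B \<and>
      (\<forall>x\<in>B. \<forall>y\<in>B. compatible_in (conds p c) (cond_le p c) x y)"
    using compat' by (intro exI[of _ "(\<lambda>F. (F, H)) ` \<G>4"]) auto
qed

section \<open>Density\<close>

text \<open>An undecided ordinal is put into a piece that is still empty, which creates no new pair
  within a piece.\<close>

lemma dense_point: "dense_in_poset (conds p c) (cond_le p c) {q \<in> conds p c. \<alpha> \<in> Domain (fst q)}"
  unfolding dense_in_poset_def
proof (intro conjI ballI)
  fix q assume q: "q \<in> conds p c"
  obtain F H where FH: "q = (F, H)" "finite F" "finite H" "single_valued F" "single_valued H"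
    "keeps_promises p c (F, H)"
    using q by (auto simp: conds_def)
  show "\<exists>d\<in>{q \<in> conds p c. \<alpha> \<in> Domain (fst q)}. (d, q) \<in> cond_le p c"
  proof (cases "\<alpha> \<in> Domain F")
    case True
    then show ?thesis
      using q FH(1) by (intro bexI[of _ q]) (auto simp: cond_le_def)
  next
    case False
    obtain i where i: "i \<notin> Range F"
      using ex_new_if_finite[OF infinite_UNIV_nat] FH(2) finite_Range by blast
    have "single_valued (insert (\<alpha>, i) F)"
      using FH(4) False unfolding single_valued_def by blast
    moreover have "keeps_promises p c (insert (\<alpha>, i) F, H)"
      using FH(6) i unfolding keeps_promises_def by auto
    ultimately have "(insert (\<alpha>, i) F, H) \<in> conds p c"
      using FH by (simp add: conds_def)
    then show ?thesis
      using q FH(1) by (intro bexI[of _ "(insert (\<alpha>, i) F, H)"]) (auto simp: cond_le_def)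
  qed
qed auto

text \<open>Only finitely many ordinals have been placed, so the largest colour among them can be
  promised.\<close>

lemma dense_promise: "dense_in_poset (conds p c) (cond_le p c) {q \<in> conds p c. ij \<in> Domain (snd q)}"
  unfolding dense_in_poset_def
proof (intro conjI ballI)
  fix q assume q: "q \<in> conds p c"
  obtain F H where FH: "q = (F, H)" "finite F" "finite H" "single_valued F" "single_valued H"
    "keeps_promises p c (F, H)"
    using q by (auto simp: conds_def)
  show "\<exists>d\<in>{q \<in> conds p c. ij \<in> Domain (snd q)}. (d, q) \<in> cond_le p c"
  proof (cases "ij \<in> Domain H")
    case True
    then show ?thesis
      using q FH(1) by (intro bexI[of _ q]) (auto simp: cond_le_def)
  next
    case False
    \<comment> \<open>The maximum also runs over non-increasing pairs, which only enlarges the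
      bound. For empty \<open>F\<close> it is unspecified, but then no pair has to respect
      it.\<close>
    define k where "k = Max (c ` (Domain F \<times> Domain F))"
    have k: "c (\<alpha>, \<beta>) \<le> k" if "(\<alpha>, i) \<in> F" "(\<beta>, i) \<in> F" for \<alpha> \<beta> i
      unfolding k_def using that FH(2) by (intro Max_ge) (auto simp: finite_Domain)
    have "single_valued (insert (ij, k) H)"
      using FH(5) False unfolding single_valued_def by blast
    moreover have "keeps_promises p c (F, insert (ij, k) H)"
      using FH(6) k unfolding keeps_promises_def by auto
    ultimately have "(F, insert (ij, k) H) \<in> conds p c"
      using FH by (simp add: conds_def)
    then show ?thesis
      using q FH(1) by (intro bexI[of _ "(F, insert (ij, k) H)"]) (auto simp: cond_le_def)
  qed
qed auto

section \<open>Reading the decomposition off the filter\<close>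

theorem theorem3p7:
  fixes p c :: "omega1 \<times> omega1 \<Rightarrow> nat"
  assumes "cardSuc natLeq \<le>o |UNIV :: 'p set|"
    and "MA_aleph1_K TYPE('p)"
    and "witnesses_U p"
  shows "\<exists>X :: nat \<Rightarrow> omega1 set.
    disjoint_family X \<and> (\<Union>i. X i) = UNIV \<and>
    (\<forall>i j. finite {c (\<alpha>, \<beta>) | \<alpha> \<beta>. (\<alpha>, \<beta>) \<in> pairs2 (X i) \<and> p (\<alpha>, \<beta>) = j})"
proof -
  define D1 where "D1 \<alpha> = {q \<in> conds p c. \<alpha> \<in> Domain (fst q)}" for \<alpha>
  define D2 where "D2 ij = {q \<in> conds p c. ij \<in> Domain (snd q)}" for ij
  \<comment> \<open>The sets \<open>D2\<close> have countably many indices, and the sets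
    \<open>D1\<close> are indexed by \<open>\<omega>\<^sub>1\<close>, so together they number at
    most \<aleph>\<open>\<^sub>1\<close>.\<close>
  have "|range D2| \<le>o natLeq"
    by (simp flip: countable_card_le_natLeq)
  then have "|range D2| \<le>o cardSuc natLeq"
    by (rule ordLeq_transitive[OF _ ordLess_imp_ordLeq[OF cardSuc_greater[OF natLeq_Card_order]]])
  moreover have "|range D1| \<le>o cardSuc natLeq"
    by (rule ordLeq_ordIso_trans[OF card_of_image card_of_omega1])
  moreover have "infinite (Field (cardSuc natLeq))"
    using cardSuc_finite[OF natLeq_Card_order] Field_natLeq infinite_UNIV_nat by metis
  ultimately have few: "|range D1 \<union> range D2| \<le>o cardSuc natLeq"
    using Card_order_cardSuc_natLeq by (intro card_of_Un_ordLeq_infinite_Field)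
  have card: "|conds p c| \<le>o |UNIV :: 'p set|"
    by (rule ordLeq_transitive[OF card_of_conds assms(1)])
  have "({}, {}) \<in> conds p c"
    by (simp add: conds_def keeps_promises_def)
  then have ne: "conds p c \<noteq> {}"
    by blast
  have dense: "dense_in_poset (conds p c) (cond_le p c) D" if "D \<in> range D1 \<union> range D2" for D
    using that dense_point dense_promise unfolding D1_def D2_def by blast
  obtain G where G: "poset_filter (conds p c) (cond_le p c) G"
    "\<forall>D\<in>range D1 \<union> range D2. G \<inter> D \<noteq> {}"
    by (rule MA_aleph1_K_transfer[OF assms(2) card ne partial_order_on_cond_le
        property_K_conds[OF assms(3)] few dense])
  \<comment> \<open>Directedness collects decisions and promises of different members of
    \<open>G\<close> in a single condition, whose defining properties then apply to them.\<close>
  have common: "\<exists>r\<in>G. r \<in> conds p c \<and> fst q \<union> fst q' \<subseteq> fst r \<and> snd q \<union> snd q' \<subseteq> snd r"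
    if qq': "q \<in> G" "q' \<in> G" for q q'
  proof -
    obtain r where "r \<in> G" "(r, q) \<in> cond_le p c" "(r, q') \<in> cond_le p c"
      using G(1) qq' unfolding poset_filter_def by meson
    then show ?thesis
      by (auto simp: cond_le_def)
  qed
  define X where "X i = {\<alpha>. \<exists>q\<in>G. (\<alpha>, i) \<in> fst q}" for i
  have "disjoint_family X"
    unfolding disjoint_family_on_def
  proof (intro ballI impI)
    fix m n :: nat assume "m \<noteq> n"
    show "X m \<inter> X n = {}"
    proof (rule ccontr)
      assume "X m \<inter> X n \<noteq> {}"
      then obtain \<alpha> q q' where q: "q \<in> G" "q' \<in> G" "(\<alpha>, m) \<in> fst q" "(\<alpha>, n) \<in> fst q'"
        by (auto simp: X_def)
      obtain r where "r \<in> conds p c" "fst q \<union> fst q' \<subseteq> fst r"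
        using common[OF q(1,2)] by blast
      then have "single_valued (fst r)" "(\<alpha>, m) \<in> fst r" "(\<alpha>, n) \<in> fst r"
        using q(3,4) by (auto simp: conds_def)
      then show False
        using \<open>m \<noteq> n\<close> by (auto dest: single_valuedD)
    qed
  qed
  moreover have "(\<Union>i. X i) = UNIV"
  proof -
    have "\<alpha> \<in> (\<Union>i. X i)" for \<alpha>
      using bspec[OF G(2), of "D1 \<alpha>"] by (auto simp: D1_def X_def)
    then show ?thesis
      by blast
  qed
  moreover have "finite {c (\<alpha>, \<beta>) | \<alpha> \<beta>. (\<alpha>, \<beta>) \<in> pairs2 (X i) \<and> p (\<alpha>, \<beta>) = j}" for i j
  proof -
    \<comment> \<open>Meeting \<open>D2 (i, j)\<close> yields one bound \<open>k\<close> for all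
      pairs; \<open>k\<close> is chosen before \<alpha> and \<beta>, which may be placed by other
      members of \<open>G\<close>.\<close>
    obtain q k where q: "q \<in> G" "((i, j), k) \<in> snd q"
      using bspec[OF G(2), of "D2 (i, j)"] by (auto simp: D2_def)
    have "c (\<alpha>, \<beta>) \<le> k" if ab: "\<alpha> \<in> X i" "\<beta> \<in> X i" "\<alpha> < \<beta>" "p (\<alpha>, \<beta>) = j" for \<alpha> \<beta>
    proof -
      obtain q1 q2 where 12: "q1 \<in> G" "q2 \<in> G" "(\<alpha>, i) \<in> fst q1" "(\<beta>, i) \<in> fst q2"
        using ab by (auto simp: X_def)
      obtain q3 where 3: "q3 \<in> G" "fst q1 \<union> fst q2 \<subseteq> fst q3"
        using common[OF 12(1,2)] by blast
      obtain r where r: "r \<in> conds p c" "fst q3 \<subseteq> fst r" "snd q \<subseteq> snd r"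
        using common[OF 3(1) q(1)] by blast
      have "(\<alpha>, i) \<in> fst r" "(\<beta>, i) \<in> fst r" "((i, p (\<alpha>, \<beta>)), k) \<in> snd r"
        using 12 3 q(2) r(2,3) ab(4) by auto
      moreover have "keeps_promises p c (fst r, snd r)"
        using r(1) by (auto simp: conds_def)
      ultimately show ?thesis
        using ab(3) unfolding keeps_promises_def by blast
    qed
    then have "{c (\<alpha>, \<beta>) | \<alpha> \<beta>. (\<alpha>, \<beta>) \<in> pairs2 (X i) \<and> p (\<alpha>, \<beta>) = j} \<subseteq> {..k}"
      by (auto simp: pairs2_def)
    then show ?thesis
      using finite_subset by blast
  qed
  ultimately show ?thesis
    by blast
qed

end
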